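(* There is an absolute constant $c>0$ such that the following holds. Let $A=\{a_1<a_2<\cdots<a_k\}$ and $A'=\{a'_1<a'_2<\cdots<a'_k\}$ be nonempty finite sets of real numbers with $|A|=|A'|=k$, and let $d_i=a_{i+1}-a_i$ and $d'_i=a'_{i+1}-a'_i$ for $i=1,\ldots,k-1$. Suppose that $A$ and $A'$ have distinct pairs of consecutive differences, i.e. there is a one-to-one map $\sigma:\{1,\ldots,k-1\}\to\{1,\ldots,k-1\}$ such that the $k-1$ ordered pairs $(d_i,d'_{\sigma(i)})$, $i=1,\ldots,k-1$, are pairwise distinct. Let $B$ and $B'$ be nonempty finite sets of real numbers with $|B|=\ell$ and $|B'|=\ell'$. Then \[ |A+B|\cdot|A'+B'| \geq c\left(k^3\ell\ell'\right)^{1/2}. \] In particular, if $\ell=\ell'=k$, then $|A+B|\cdot|A'+B'|\geq c\,k^{5/2}$.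
   Context: For sets of real numbers $X,Y$, the sumset is $X+Y=\{x+y : x\in X,\ y\in Y\}$. *)

theory Defs
  imports Complex_Main "HOL-Library.Set_Algebras" "HOL-Library.FuncSet"
begin

text \<open>Sumsets are written \<open>A + B\<close>, with the pointwise addition of sets of
  \<open>HOL-Library.Set_Algebras\<close>.\<close>

text \<open>A \<open>k\<close>-element set \<open>{a\<^sub>1 < \<dots> < a\<^sub>k}\<close> is given together with its increasing enumeration,
  indexed from 1; values of \<open>a\<close> outside \<open>{1..k}\<close> are irrelevant.\<close>

definition increasing_enum :: "nat \<Rightarrow> (nat \<Rightarrow> real) \<Rightarrow> real set \<Rightarrow> bool" where
  "increasing_enum k a A \<longleftrightarrow> strict_mono_on {1..k} a \<and> A = a ` {1..k}"

definition consec_diff :: "(nat \<Rightarrow> real) \<Rightarrow> nat \<Rightarrow> real" where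
  "consec_diff a i = a (i + 1) - a i"

text \<open>The index set \<open>{1..<k}\<close> is \<open>{1, \<dots>, k - 1}\<close>.\<close>

definition distinct_consec_diff_pairs ::
    "nat \<Rightarrow> (nat \<Rightarrow> real) \<Rightarrow> (nat \<Rightarrow> real) \<Rightarrow> bool" where
  "distinct_consec_diff_pairs k a a' \<longleftrightarrow>
     (\<exists>\<sigma>. \<sigma> \<in> {1..<k} \<rightarrow> {1..<k} \<and> inj_on \<sigma> {1..<k} \<and>
          inj_on (\<lambda>i. (consec_diff a i, consec_diff a' (\<sigma> i))) {1..<k})"

end

theory Submission
  imports Defs
begin

text \<open>
  Write \<open>S = A + B\<close>, \<open>S' = A' + B'\<close> and \<open>m = k - 1\<close>. For fixed \<open>b\<close>, the half-open intervals
  \<open>[a\<^sub>i + b, a\<^bsub>i+1\<^esub> + b)\<close> are disjoint, so by Markov's inequality all but a third of them contain at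
  most \<open>3|S|/m\<close> elements of \<open>S\<close>; the same holds for \<open>b'\<close> and \<open>S'\<close>. Hence for each \<open>(b, b')\<close> at
  least \<open>m/3\<close> indices \<open>i\<close> give two short intervals at once, with ends \<open>a\<^sub>i + b\<close>, \<open>a\<^bsub>i+1\<^esub> + b\<close>
  and \<open>a'\<^bsub>\<sigma>(i)\<^esub> + b'\<close>, \<open>a'\<^bsub>\<sigma>(i)+1\<^esub> + b'\<close>. The four ends determine the
  pair of differences, hence \<open>i\<close>, and then \<open>b\<close> and \<open>b'\<close>. As \<open>S\<close> has at most \<open>|S| \<cdot> 3|S|/m\<close> pairs
  spanning a short interval, \<open>\<ell>\<ell>'m/3 \<le> (3|S|\<^sup>2/m)(3|S'|\<^sup>2/m)\<close>.
\<close>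

definition close_pairs :: "'a::linorder set \<Rightarrow> real \<Rightarrow> ('a \<times> 'a) set" where
  "close_pairs S r = {(s, t). s \<in> S \<and> t \<in> S \<and> s < t \<and> real (card (S \<inter> {s..<t})) \<le> r}"

lemma finite_close_pairs: "finite S \<Longrightarrow> finite (close_pairs S r)"
  by (rule finite_subset[of _ "S \<times> S"]) (auto simp: close_pairs_def)

text \<open>The largest admissible \<open>t\<close>, called \<open>M\<close>, controls all the
  others: they lie in \<open>S \<inter> {s..<M}\<close> together with \<open>s\<close>. Counting
  \<open>s\<close> in place of \<open>M\<close> makes up for the excluded right end, so this set has
  at least as many elements as there are admissible \<open>t\<close>, and at most \<open>r\<close>
  by the choice of \<open>M\<close>.\<close>

lemma card_close_right:
  fixes S :: "'a::linorder set"
  assumes S: "finite S" and s: "s \<in> S" and r: "r \<ge> 0"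
  shows "real (card {t \<in> S. s < t \<and> real (card (S \<inter> {s..<t})) \<le> r}) \<le> r"
proof -
  define T where "T = {t \<in> S. s < t \<and> real (card (S \<inter> {s..<t})) \<le> r}"
  have finT: "finite T" using S by (simp add: T_def)
  have "real (card T) \<le> r"
  proof (cases "T = {}")
    case False
    define M where "M = Max T"
    have M: "M \<in> T" using finT False by (simp add: M_def)
    have "t \<le> M" if "t \<in> T" for t using finT that by (simp add: M_def)
    then have sub: "insert s (T - {M}) \<subseteq> S \<inter> {s..<M}"
      using M s by (fastforce simp: T_def)
    have "card T > 0" using finT False by (simp add: card_gt_0_iff)
    moreover have "s \<notin> T - {M}" by (simp add: T_def)
    ultimately have "card T = card (insert s (T - {M}))"
      using finT M by (simp add: card_Diff_singleton)
    also have "\<dots> \<le> card (S \<inter> {s..<M})" using sub S by (intro card_mono) auto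
    finally show ?thesis using M by (simp add: T_def)
  qed (use r in simp)
  then show ?thesis by (simp add: T_def)
qed

lemma card_close_pairs:
  fixes S :: "'a::linorder set"
  assumes S: "finite S" and r: "r \<ge> 0"
  shows "real (card (close_pairs S r)) \<le> real (card S) * r"
proof -
  have "close_pairs S r = (SIGMA s:S. {t \<in> S. s < t \<and> real (card (S \<inter> {s..<t})) \<le> r})"
    by (auto simp: close_pairs_def)
  then have "real (card (close_pairs S r)) =
      (\<Sum>s\<in>S. real (card {t \<in> S. s < t \<and> real (card (S \<inter> {s..<t})) \<le> r}))"
    using S by (simp add: card_SigmaI)
  also have "\<dots> \<le> (\<Sum>s\<in>S. r)"
    by (intro sum_mono card_close_right S r)
  finally show ?thesis by simp
qed

lemma sum_card_gaps_le:
  fixes a :: "nat \<Rightarrow> real"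
  assumes a: "strict_mono_on {1..k} a" and S: "finite S"
  shows "(\<Sum>i\<in>{1..<k}. card (S \<inter> {a i + b..<a (i + 1) + b})) \<le> card S"
proof -
  have less: "S \<inter> {a i + b..<a (i + 1) + b} \<inter> (S \<inter> {a j + b..<a (j + 1) + b}) = {}"
    if "i \<in> {1..<k}" "j \<in> {1..<k}" "i < j" for i j
  proof -
    have "a (i + 1) \<le> a j"
      using that by (intro strict_mono_on_leD[OF a]) auto
    then show ?thesis by auto
  qed
  have disj: "S \<inter> {a i + b..<a (i + 1) + b} \<inter> (S \<inter> {a j + b..<a (j + 1) + b}) = {}"
    if "i \<in> {1..<k}" "j \<in> {1..<k}" "i \<noteq> j" for i j
    using less[of i j] less[of j i] that by (cases "i < j") (auto simp: Int_commute)
  have "(\<Sum>i\<in>{1..<k}. card (S \<inter> {a i + b..<a (i + 1) + b})) =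
      card (\<Union>i\<in>{1..<k}. S \<inter> {a i + b..<a (i + 1) + b})"
    using disj S by (intro card_UN_disjoint[symmetric]) auto
  also have "\<dots> \<le> card S" using S by (intro card_mono) auto
  finally show ?thesis .
qed

text \<open>Markov's inequality: the mean of \<open>f\<close> over \<open>I\<close> is at most
  \<open>N / card I\<close>, and the indices where \<open>f\<close> exceeds \<open>q\<close> times
  this bound already contribute their number times the threshold to a sum bounded by
  \<open>N\<close>.\<close>

lemma card_exceeding_le:
  fixes f :: "'a \<Rightarrow> real"
  assumes I: "finite I" "I \<noteq> {}" and f: "\<And>i. i \<in> I \<Longrightarrow> f i \<ge> 0"
    and sum: "sum f I \<le> N" and N: "N > 0" and q: "q > 0"
  shows "real (card {i \<in> I. f i > q * N / real (card I)}) \<le> real (card I) / q"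
proof -
  let ?J = "{i \<in> I. f i > q * N / real (card I)}"
  have "real (card ?J) * (q * N / real (card I)) = (\<Sum>i\<in>?J. q * N / real (card I))" by simp
  also have "\<dots> \<le> sum f ?J" by (intro sum_mono) auto
  also have "\<dots> \<le> sum f I" using I f by (intro sum_mono2) auto
  also note sum
  finally have "real (card ?J) * q * N \<le> real (card I) * N"
    using I by (simp add: field_simps card_gt_0_iff)
  then show ?thesis using N q by (simp add: field_simps)
qed

text \<open>The double count in squared form, free of roots. The constant is
  \<open>27 = 3 * 3 * 3\<close>: one factor each from \<open>r\<close> and \<open>r'\<close>, and
  one from keeping only a third of the indices.\<close>

lemma sumset_product_square_bound:
  fixes a a' :: "nat \<Rightarrow> real" and B B' :: "real set"
  assumes k: "k \<ge> 2" and A: "increasing_enum k a A" and A': "increasing_enum k a' A'"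
    and dist: "distinct_consec_diff_pairs k a a'"
    and B: "finite B" "B \<noteq> {}" and B': "finite B'" "B' \<noteq> {}"
  shows "real (k - 1) ^ 3 * real (card B) * real (card B')
    \<le> 27 * (real (card (A + B)) * real (card (A' + B'))) ^ 2"
proof -
  define S where "S = A + B"
  define S' where "S' = A' + B'"
  define I where "I = {1..<k}"
  define m where "m = real (k - 1)"
  \<comment> \<open>With the factor 3, each of the two applications of Markov's inequality discards
    at most a third of \<open>I\<close>, so a third survives both.\<close>
  define r where "r = 3 * real (card S) / m"
  define r' where "r' = 3 * real (card S') / m"
  have m: "m > 0" "real (card I) = m" using k by (auto simp: m_def I_def)
  have I: "finite I" "I \<noteq> {}" using k by (auto simp: I_def)
  from dist obtain \<sigma> where \<sigma>: "\<sigma> \<in> I \<rightarrow> I" "inj_on \<sigma> I"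
    and inj: "inj_on (\<lambda>i. (consec_diff a i, consec_diff a' (\<sigma> i))) I"
    by (auto simp: distinct_consec_diff_pairs_def I_def)
  have a: "strict_mono_on {1..k} a" "A = a ` {1..k}" using A by (auto simp: increasing_enum_def)
  have a': "strict_mono_on {1..k} a'" "A' = a' ` {1..k}"
    using A' by (auto simp: increasing_enum_def)
  have memS: "a i + b \<in> S" if "i \<in> {1..k}" "b \<in> B" for i b
    using that a by (auto simp: S_def)
  have memS': "a' i + b \<in> S'" if "i \<in> {1..k}" "b \<in> B'" for i b
    using that a' by (auto simp: S'_def)
  have S: "finite S" and S': "finite S'"
    using a a' B B' by (auto simp: S_def S'_def finite_set_plus)
  have N: "real (card S) > 0" "real (card S') > 0"
  proof -
    obtain b b' where "b \<in> B" "b' \<in> B'" using B B' by auto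
    then have "a 1 + b \<in> S" "a' 1 + b' \<in> S'" using k memS[of 1 b] memS'[of 1 b'] by auto
    then show "real (card S) > 0" "real (card S') > 0"
      using S S' by (auto simp: card_gt_0_iff)
  qed
  have r: "r \<ge> 0" "r' \<ge> 0" using m by (auto simp: r_def r'_def)
  define n where "n b i = real (card (S \<inter> {a i + b..<a (i + 1) + b}))" for b i
  define n' where "n' b i = real (card (S' \<inter> {a' (\<sigma> i) + b..<a' (\<sigma> i + 1) + b}))" for b i
  define G where "G b b' = {i \<in> I. n b i \<le> r \<and> n' b' i \<le> r'}" for b b'
  have G: "m / 3 \<le> real (card (G b b'))" for b b'
  proof -
    have 1: "sum (n b) I \<le> real (card S)"
      using sum_card_gaps_le[OF a(1) S, of b] unfolding n_def I_def of_nat_sum[symmetric]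
      by (simp only: of_nat_le_iff)
    \<comment> \<open>Injectivity of \<open>\<sigma>\<close> turns the sum into one over distinct
      gaps of \<open>A'\<close>, which is part of the sum over all gaps.\<close>
    have "sum (n' b') I = (\<Sum>j\<in>\<sigma> ` I. real (card (S' \<inter> {a' j + b'..<a' (j + 1) + b'})))"
      unfolding n'_def by (subst sum.reindex[OF \<sigma>(2)]) (simp add: o_def)
    also have "\<dots> \<le> (\<Sum>j\<in>I. real (card (S' \<inter> {a' j + b'..<a' (j + 1) + b'})))"
      using \<sigma>(1) I by (intro sum_mono2) auto
    also have "\<dots> \<le> real (card S')"
      using sum_card_gaps_le[OF a'(1) S', of b'] unfolding I_def of_nat_sum[symmetric]
      by (simp only: of_nat_le_iff)
    finally have 2: "sum (n' b') I \<le> real (card S')" .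
    define J where "J = {i \<in> I. n b i > r}"
    define J' where "J' = {i \<in> I. n' b' i > r'}"
    have J: "real (card J) \<le> m / 3"
      using card_exceeding_le[OF I _ 1 N(1), of 3] m by (simp add: J_def r_def n_def)
    have J': "real (card J') \<le> m / 3"
      using card_exceeding_le[OF I _ 2 N(2), of 3] m by (simp add: J'_def r'_def n'_def)
    have "I = G b b' \<union> J \<union> J'" by (auto simp: G_def J_def J'_def)
    then have "card I \<le> card (G b b') + card J + card J'"
      by (metis card_Un_le add_le_mono1 le_trans)
    then show ?thesis using J J' m(2) by linarith
  qed
  \<comment> \<open>The triples \<open>(b, b', i)\<close> in \<open>W\<close> are counted twice:
    from below by \<open>G\<close>, and from above through the injection \<open>F\<close> into pairs
    of close pairs.\<close>
  define W where "W = (SIGMA p:B \<times> B'. G (fst p) (snd p))"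
  define F where "F = (\<lambda>((b, b'), i). ((a i + b, a (i + 1) + b),
                                         (a' (\<sigma> i) + b', a' (\<sigma> i + 1) + b')))"
  have "inj_on F W"
  proof (rule inj_onI)
    fix w1 w2 assume "w1 \<in> W" "w2 \<in> W" "F w1 = F w2"
    moreover obtain b1 b1' i1 b2 b2' i2
      where w: "w1 = ((b1, b1'), i1)" "w2 = ((b2, b2'), i2)"
      by (metis surj_pair)
    ultimately have W: "((b1, b1'), i1) \<in> W" "((b2, b2'), i2) \<in> W"
      and eq: "F ((b1, b1'), i1) = F ((b2, b2'), i2)" by auto
    have "i1 \<in> I" "i2 \<in> I" using W by (auto simp: W_def G_def)
    \<comment> \<open>Subtracting the two ends of each interval cancels the shifts \<open>b\<close>
      and \<open>b'\<close>. Once \<open>i\<close> is recovered from the differences, the left ends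
      give back \<open>b\<close> and \<open>b'\<close>.\<close>
    moreover have "consec_diff a i1 = consec_diff a i2"
      "consec_diff a' (\<sigma> i1) = consec_diff a' (\<sigma> i2)"
      using eq by (auto simp: F_def consec_diff_def)
    ultimately have "i1 = i2" using inj by (auto dest: inj_onD)
    then show "w1 = w2" using eq by (auto simp: w F_def)
  qed
  moreover have "F ` W \<subseteq> close_pairs S r \<times> close_pairs S' r'"
  proof (rule image_subsetI)
    fix w assume "w \<in> W"
    then obtain b b' i where w: "w = ((b, b'), i)" and W: "((b, b'), i) \<in> W"
      by (metis surj_pair)
    then have b: "b \<in> B" "b' \<in> B'" and i: "i \<in> I" "n b i \<le> r" "n' b' i \<le> r'"
      by (auto simp: W_def G_def)
    have \<sigma>i: "\<sigma> i \<in> I" using \<sigma>(1) i by auto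
    have "a i < a (i + 1)" using i by (intro strict_mono_onD[OF a(1)]) (auto simp: I_def)
    moreover have "a' (\<sigma> i) < a' (\<sigma> i + 1)"
      using \<sigma>i by (intro strict_mono_onD[OF a'(1)]) (auto simp: I_def)
    ultimately show "F w \<in> close_pairs S r \<times> close_pairs S' r'"
      using b i \<sigma>i memS[of i b] memS[of "i + 1" b] memS'[of "\<sigma> i" b'] memS'[of "\<sigma> i + 1" b']
      by (simp add: w F_def close_pairs_def n_def n'_def I_def)
  qed
  ultimately have "card W \<le> card (close_pairs S r \<times> close_pairs S' r')"
    using S S' by (intro card_inj_on_le[of F]) (auto simp: finite_close_pairs)
  then have "real (card W) \<le> real (card (close_pairs S r)) * real (card (close_pairs S' r'))"
    unfolding card_cartesian_product of_nat_mult[symmetric] of_nat_le_iff .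
  also have "\<dots> \<le> (real (card S) * r) * (real (card S') * r')"
    using r by (intro mult_mono card_close_pairs S S') auto
  finally have upper: "real (card W) \<le> (real (card S) * r) * (real (card S') * r')" .
  have "real (card B) * real (card B') * (m / 3) = (\<Sum>p\<in>B \<times> B'. m / 3)"
    by (simp add: card_cartesian_product)
  also have "\<dots> \<le> (\<Sum>p\<in>B \<times> B'. real (card (G (fst p) (snd p))))"
    by (intro sum_mono G)
  also have "\<dots> = real (card W)"
    using B B' I unfolding W_def by (subst card_SigmaI) (auto simp: G_def)
  also note upper
  finally show ?thesis
    using m(1) unfolding r_def r'_def S_def[symmetric] S'_def[symmetric] m_def[symmetric]
    by (simp add: field_simps power2_eq_square power3_eq_cube)
qed

text \<open>Passing from \<open>k - 1\<close> to \<open>k\<close> costs a factor 8 by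
  \<open>k \<le> 2 * (k - 1)\<close>, and \<open>8 * 27 = 216\<close> is at most
  \<open>16 ^ 2\<close>, whence the constant 16 after taking roots.\<close>

lemma sumset_product_bound:
  fixes a a' :: "nat \<Rightarrow> real" and B B' :: "real set"
  assumes k: "k \<ge> 1" and A: "increasing_enum k a A" and A': "increasing_enum k a' A'"
    and dist: "distinct_consec_diff_pairs k a a'"
    and B: "finite B" "B \<noteq> {}" and B': "finite B'" "B' \<noteq> {}"
  shows "(real k ^ 3 * real (card B) * real (card B')) powr (1 / 2) / 16
    \<le> real (card (A + B)) * real (card (A' + B'))"
proof -
  define P where "P = real (card (A + B)) * real (card (A' + B'))"
  define L where "L = real (card B) * real (card B')"
  have L: "L \<ge> 1"
    using B B' by (simp add: L_def Suc_le_eq card_gt_0_iff flip: of_nat_mult)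
  have P: "P \<ge> 0" by (simp add: P_def)
  have main: "real k ^ 3 * L \<le> (16 * P)\<^sup>2"
  \<comment> \<open>For \<open>k = 1\<close> there are no gaps to count. Both sumsets are then
    translates, so \<open>P = L\<close>, and \<open>L \<ge> 1\<close> gives
    \<open>L \<le> L * L\<close>.\<close>
  proof (cases "k = 1")
    case True
    have "A = {a 1}" "A' = {a' 1}" using A A' True by (auto simp: increasing_enum_def)
    then have "A + B = (\<lambda>x. a 1 + x) ` B" "A' + B' = (\<lambda>x. a' 1 + x) ` B'"
      by (auto simp: set_plus_def)
    then have "P = L" by (simp add: P_def L_def card_image)
    moreover have "L * 1 \<le> L * L" using L by (intro mult_left_mono) auto
    ultimately show ?thesis using True L by (simp add: power2_eq_square)
  next
    case False
    then have k2: "k \<ge> 2" using k by simp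
    have "real k ^ 3 \<le> (2 * real (k - 1)) ^ 3" using k2 by (intro power_mono) auto
    then have "real k ^ 3 * L \<le> 8 * real (k - 1) ^ 3 * L"
      using L by (intro mult_right_mono) (auto simp: power_mult_distrib)
    also have "\<dots> \<le> 8 * (27 * P\<^sup>2)"
      using sumset_product_square_bound[OF k2 A A' dist B B'] by (simp add: P_def L_def mult_ac)
    also have "\<dots> \<le> (16 * P)\<^sup>2" by (simp add: power_mult_distrib)
    finally show ?thesis .
  qed
  have "(real k ^ 3 * L) powr (1 / 2) = sqrt (real k ^ 3 * L)"
    using L by (simp add: powr_half_sqrt)
  also have "\<dots> \<le> 16 * P" using main P by (intro real_le_lsqrt) auto
  finally show ?thesis by (simp add: P_def L_def mult.assoc)
qed

theorem theorem3:
  shows "\<exists>c::real. c > 0 \<and>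
    (\<forall>(k::nat) (l::nat) (l'::nat) (A::real set) (A'::real set)
       (a::nat \<Rightarrow> real) (a'::nat \<Rightarrow> real) (B::real set) (B'::real set).
       k \<ge> 1 \<longrightarrow>
       increasing_enum k a A \<longrightarrow>
       increasing_enum k a' A' \<longrightarrow>
       distinct_consec_diff_pairs k a a' \<longrightarrow>
       finite B \<longrightarrow> B \<noteq> {} \<longrightarrow> card B = l \<longrightarrow>
       finite B' \<longrightarrow> B' \<noteq> {} \<longrightarrow> card B' = l' \<longrightarrow>
       real (card (A + B)) * real (card (A' + B'))
         \<ge> c * (real k ^ 3 * real l * real l') powr (1 / 2) \<and>
       (l = k \<and> l' = k \<longrightarrow>
         real (card (A + B)) * real (card (A' + B')) \<ge> c * real k powr (5 / 2)))"
proof (intro exI[of _ "1/16 :: real"] conjI allI impI)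
  fix k l l' :: nat and A A' :: "real set" and a a' :: "nat \<Rightarrow> real" and B B' :: "real set"
  assume k: "k \<ge> 1" and A: "increasing_enum k a A" "increasing_enum k a' A'"
    and dist: "distinct_consec_diff_pairs k a a'"
    and B: "finite B" "B \<noteq> {}" "card B = l" and B': "finite B'" "B' \<noteq> {}" "card B' = l'"
  have bound: "1/16 * (real k ^ 3 * real l * real l') powr (1 / 2)
      \<le> real (card (A + B)) * real (card (A' + B'))"
    using sumset_product_bound[OF k A dist B(1,2) B'(1,2)] B(3) B'(3) by simp
  then show "real (card (A + B)) * real (card (A' + B'))
      \<ge> 1/16 * (real k ^ 3 * real l * real l') powr (1 / 2)" .
  assume l: "l = k \<and> l' = k"
  have "real k ^ 3 * real l * real l' = real k ^ 5"
    using l by (simp add: eval_nat_numeral)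
  \<comment> \<open>Rewriting the power as \<open>powr\<close> lets the exponents multiply to
    \<open>5 / 2\<close>; \<open>k \<ge> 1\<close> supplies the positive base.\<close>
  also have "\<dots> = real k powr 5" using k by (simp add: powr_numeral)
  finally have "(real k ^ 3 * real l * real l') powr (1 / 2) = real k powr (5 / 2)"
    by (simp only: powr_powr) simp
  with bound show "real (card (A + B)) * real (card (A' + B')) \<ge> 1/16 * real k powr (5 / 2)"
    by simp
qed simp

end
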